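(* Let $\mathsf{A}_1^{(n)}\in\mathbb{R}^{J_n\times J_n}$, $n=1,\dots,N$, with spectral radii $\rho^{(n)}$. Consider the unforced multilinear time-invariant system $$\mathsf{X}_{t+1}=\mathsf{X}_t\times\{\mathsf{A}_1^{(1)},\dots,\mathsf{A}_1^{(N)}\},\qquad \mathsf{X}_t\in\mathbb{R}^{J_1\times\cdots\times J_N}.$$ This system (its equilibrium point $\mathsf{X}=\mathsf{O}$) is 1. stable if and only if $\prod_{n=1}^N\rho^{(n)}\le1$ and, in the case $\prod_{n=1}^N\rho^{(n)}=1$, for every $n$ each eigenvalue of $\mathsf{A}_1^{(n)}$ of modulus $\rho^{(n)}$ has equal algebraic and geometric multiplicity; 2. asymptotically stable if $\prod_{n=1}^N\rho^{(n)}<1$; 3. unstable if $\prod_{n=1}^N\rho^{(n)}>1$.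
   Context: The Tucker product of $\mathsf{X}\in\mathbb{R}^{J_1\times\cdots\times J_N}$ with matrices $\mathbf{M}_n\in\mathbb{R}^{J_n\times J_n}$ is $(\mathsf{X}\times\{\mathbf{M}_1,\dots,\mathbf{M}_N\})_{i_1\cdots i_N}=\sum_{j_1,\dots,j_N}\mathsf{X}_{j_1\cdots j_N}(\mathbf{M}_1)_{i_1j_1}\cdots(\mathbf{M}_N)_{i_Nj_N}$. $\|\cdot\|$ is the Frobenius norm and $\mathsf{O}$ the zero tensor. The equilibrium $\mathsf{X}=\mathsf{O}$ is stable if there is $\gamma>0$ with $\|\mathsf{X}_t\|\le\gamma\|\mathsf{X}_0\|$ for all $t\ge 0$ and all initial conditions $\mathsf{X}_0$; asymptotically stable if $\|\mathsf{X}_t\|\to0$ as $t\to\infty$ for every $\mathsf{X}_0$; unstable if it is not stable. *)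

theory Defs
  imports "HOL-Library.FuncSet" "Jordan_Normal_Form.Spectral_Radius"
    "Jordan_Normal_Form.Jordan_Normal_Form_Uniqueness"
begin

text \<open>Modes are numbered \<open>1, \<dots>, N\<close>; within mode \<open>n\<close> indices run over \<open>{..<J n}\<close>, matching the
  0-based indexing of type \<open>mat\<close>.\<close>

definition multi_index :: "nat \<Rightarrow> (nat \<Rightarrow> nat) \<Rightarrow> (nat \<Rightarrow> nat) set" where
  "multi_index N J = (\<Pi>\<^sub>E n\<in>{1..N}. {..<J n})"

text \<open>A tensor is represented by its family of entries, extended by zero outside the index set so
  that equality of functions is equality of tensors; the zero tensor is \<open>\<lambda>_. 0\<close>.\<close>

type_synonym tensor = "(nat \<Rightarrow> nat) \<Rightarrow> real"

definition tensors :: "nat \<Rightarrow> (nat \<Rightarrow> nat) \<Rightarrow> tensor set" where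
  "tensors N J = {X. \<forall>i. i \<notin> multi_index N J \<longrightarrow> X i = 0}"

definition tensor_norm :: "nat \<Rightarrow> (nat \<Rightarrow> nat) \<Rightarrow> tensor \<Rightarrow> real" where
  "tensor_norm N J X = sqrt (\<Sum>i\<in>multi_index N J. (X i)\<^sup>2)"

definition tucker_product ::
  "nat \<Rightarrow> (nat \<Rightarrow> nat) \<Rightarrow> tensor \<Rightarrow> (nat \<Rightarrow> real mat) \<Rightarrow> tensor" where
  "tucker_product N J X M = (\<lambda>i. if i \<in> multi_index N J
     then \<Sum>j\<in>multi_index N J. X j * (\<Prod>n=1..N. M n $$ (i n, j n)) else 0)"

lemma tucker_product_in_tensors: "tucker_product N J X M \<in> tensors N J"
  by (simp add: tensors_def tucker_product_def)

lemma tucker_product_zero: "tucker_product N J (\<lambda>_. 0) M = (\<lambda>_. 0)"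
  by (simp add: tucker_product_def fun_eq_iff)

definition mlti_trajectory ::
  "nat \<Rightarrow> (nat \<Rightarrow> nat) \<Rightarrow> (nat \<Rightarrow> real mat) \<Rightarrow> (nat \<Rightarrow> tensor) \<Rightarrow> bool" where
  "mlti_trajectory N J A X \<longleftrightarrow>
     X 0 \<in> tensors N J \<and> (\<forall>t. X (Suc t) = tucker_product N J (X t) A)"

definition mlti_stable :: "nat \<Rightarrow> (nat \<Rightarrow> nat) \<Rightarrow> (nat \<Rightarrow> real mat) \<Rightarrow> bool" where
  "mlti_stable N J A \<longleftrightarrow> (\<exists>\<gamma>>0. \<forall>X. mlti_trajectory N J A X \<longrightarrow>
     (\<forall>t. tensor_norm N J (X t) \<le> \<gamma> * tensor_norm N J (X 0)))"

definition mlti_asymptotically_stable ::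
  "nat \<Rightarrow> (nat \<Rightarrow> nat) \<Rightarrow> (nat \<Rightarrow> real mat) \<Rightarrow> bool" where
  "mlti_asymptotically_stable N J A \<longleftrightarrow> (\<forall>X. mlti_trajectory N J A X \<longrightarrow>
     (\<lambda>t. tensor_norm N J (X t)) \<longlonglongrightarrow> 0)"

definition mlti_unstable :: "nat \<Rightarrow> (nat \<Rightarrow> nat) \<Rightarrow> (nat \<Rightarrow> real mat) \<Rightarrow> bool" where
  "mlti_unstable N J A \<longleftrightarrow> \<not> mlti_stable N J A"

text \<open>Eigenvalues of a real matrix, and hence its spectral radius and the multiplicities below,
  are taken over the complex numbers.\<close>

abbreviation complexify :: "real mat \<Rightarrow> complex mat" where
  "complexify \<equiv> map_mat complex_of_real"

definition alg_multiplicity :: "'a::field mat \<Rightarrow> 'a \<Rightarrow> nat" where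
  "alg_multiplicity A e = Polynomial.order e (char_poly A)"

text \<open>\<open>char_matrix A e\<close> is \<open>A - e I\<close>, so its kernel is the eigenspace of \<open>e\<close>.\<close>

definition geom_multiplicity :: "'a::field mat \<Rightarrow> 'a \<Rightarrow> nat" where
  "geom_multiplicity A e = kernel_dim (char_matrix A e)"

end

theory Submission
  imports Defs "HOL-Analysis.L2_Norm"
begin

text \<open>The state is \<open>X\<^sub>t = X\<^sub>0 \<times> {A\<^sub>1\<^sup>t, \<dots>, A\<^sub>N\<^sup>t}\<close>, and started from the unit tensors it has the products of
  one entry of each \<open>A\<^sub>n\<^sup>t\<close> as entries. Hence the orbits are uniformly bounded iff the product over
  \<open>n\<close> of the largest entries of \<open>A\<^sub>n\<^sup>t\<close> is bounded in \<open>t\<close>. A largest entry is at most \<open>C r\<^sup>t\<close> for every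
  \<open>r > \<rho>\<^sub>n\<close> by the Jordan normal form, with \<open>r = \<rho>\<^sub>n\<close> allowed if the dominant Jordan blocks are
  trivial. It is at least \<open>c \<rho>\<^sub>n\<^sup>t\<close> because of an eigenvector, and at least \<open>(c t - d) \<rho>\<^sub>n\<^sup>t\<close> if a
  dominant eigenvalue has a generalized eigenvector of rank two.\<close>

subsection \<open>Growth of matrix powers\<close>

lemma pow_smult_mat:
  fixes A :: "'a::comm_ring_1 mat"
  assumes A: "A \<in> carrier_mat n n"
  shows "(c \<cdot>\<^sub>m A) ^\<^sub>m k = c ^ k \<cdot>\<^sub>m A ^\<^sub>m k"
proof (induction k)
  case 0
  show ?case by (intro eq_matI) auto
next
  case (Suc k)
  have Ak: "A ^\<^sub>m k \<in> carrier_mat n n" using A by simp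
  have "(c \<cdot>\<^sub>m A) ^\<^sub>m Suc k = (c ^ k \<cdot>\<^sub>m A ^\<^sub>m k) * (c \<cdot>\<^sub>m A)"
    using Suc by simp
  also have "\<dots> = c ^ Suc k \<cdot>\<^sub>m A ^\<^sub>m Suc k"
    using A Ak by (intro eq_matI) (auto simp: mult_ac)
  finally show ?case .
qed

text \<open>Dividing \<open>A\<close> by \<open>r\<close> moves all eigenvalues into the closed unit
  disc and leaves only trivial Jordan blocks on the unit circle, so the powers of the scaled matrix
  stay bounded. Undoing the scaling produces the factor \<open>r ^ k\<close>.\<close>

lemma norm_bound_pow_scaled:
  fixes A :: "complex mat"
  assumes A: "A \<in> carrier_mat n n" and jnf: "jordan_nf A n_as" and r: "r > 0"
    and le: "\<And>m a. (m, a) \<in> set n_as \<Longrightarrow> cmod a \<le> r"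
    and eq: "\<And>m a. (m, a) \<in> set n_as \<Longrightarrow> cmod a = r \<Longrightarrow> m \<le> 1"
  shows "\<exists>C. \<forall>k. norm_bound (A ^\<^sub>m k) (C * r ^ k)"
proof -
  define c where "c = complex_of_real (1 / r)"
  have c0: "c \<noteq> 0" and cn: "cmod c = 1 / r"
    using r by (auto simp: c_def norm_divide)
  have cA: "c \<cdot>\<^sub>m A \<in> carrier_mat n n" using A by simp
  \<comment> \<open>The polynomial degree is the block size bound on the unit circle, here 1, minus
    one. Since \<open>0 ^ 0 = 1\<close>, the bound is the constant \<open>c1 + c2\<close> even for
    \<open>k = 0\<close>.\<close>
  have "\<exists>c1 c2. \<forall>k. norm_bound ((c \<cdot>\<^sub>m A) ^\<^sub>m k) (c1 + c2 * of_nat k ^ (1 - 1))"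
  proof (rule jordan_nf_matrix_poly_bound[OF cA _ _ jordan_nf_smult[OF jnf c0]])
    fix m a assume "(m, a) \<in> set (map (\<lambda>(n, a). (n, c * a)) n_as)"
    then obtain b where b: "(m, b) \<in> set n_as" "a = c * b" by auto
    show "norm a \<le> 1"
      using le[OF b(1)] r by (simp add: b(2) norm_mult cn)
    show "m \<le> 1" if "norm a = 1"
      using eq[OF b(1)] r that by (simp add: b(2) norm_mult cn)
  qed
  then obtain C where C: "\<And>k. norm_bound ((c \<cdot>\<^sub>m A) ^\<^sub>m k) C"
    by auto
  have "norm_bound (A ^\<^sub>m k) (C * r ^ k)" for k
  proof
    fix i j assume ij: "i < dim_row (A ^\<^sub>m k)" "j < dim_col (A ^\<^sub>m k)"
    have "norm (((c \<cdot>\<^sub>m A) ^\<^sub>m k) $$ (i, j)) \<le> C"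
      using C[of k] ij A unfolding norm_bound_def pow_smult_mat[OF A] by simp
    then have "norm ((A ^\<^sub>m k) $$ (i, j)) / r ^ k \<le> C"
      using ij by (simp add: pow_smult_mat[OF A] norm_mult norm_power cn power_one_over)
    then show "norm ((A ^\<^sub>m k) $$ (i, j)) \<le> C * r ^ k"
      using r by (simp add: field_simps)
  qed
  then show ?thesis by blast
qed

lemma jordan_nf_exists_complex:
  assumes "(A :: complex mat) \<in> carrier_mat n n"
  shows "\<exists>n_as. jordan_nf A n_as"
  using char_poly_factorized[OF assms] jordan_nf_exists[OF assms] by blast

lemma jordan_nf_eigenvalue:
  fixes A :: "'a::field mat"
  assumes A: "A \<in> carrier_mat n n" and jnf: "jordan_nf A n_as" and mem: "(m, a) \<in> set n_as"
  shows "eigenvalue A a"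
proof -
  \<comment> \<open>A Jordan normal form has no empty blocks, so the block contributes a positive
    order to the root \<open>a\<close> of the characteristic polynomial.\<close>
  have "m \<noteq> 0" using jnf mem unfolding jordan_nf_def by force
  with jordan_nf_block_size_order_bound[OF jnf mem] have "Polynomial.order a (char_poly A) \<noteq> 0" by simp
  then have "poly (char_poly A) a = 0" using order_root by blast
  then show ?thesis using eigenvalue_root_char_poly[OF A] by simp
qed

lemma eigenvalue_le_spectral_radius:
  assumes A: "A \<in> carrier_mat n n" and "eigenvalue A e"
  shows "cmod e \<le> spectral_radius A"
  using spectral_radius_mem_max(2)[OF A] eigenvalue_imp_nonzero_dim[OF A] assms(2)
  by (auto simp: spectrum_def)

text \<open>With \<open>r\<close> strictly above the spectral radius no eigenvalue has modulus
  \<open>r\<close>, so the condition on block sizes is vacuous. Non-negativity of the spectral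
  radius makes \<open>r\<close> positive.\<close>

lemma norm_bound_pow_gt_spectral_radius:
  assumes A: "A \<in> carrier_mat n n" and n: "n > 0" and r: "r > spectral_radius A"
  shows "\<exists>C. \<forall>k. norm_bound (A ^\<^sub>m k) (C * r ^ k)"
proof -
  obtain n_as where jnf: "jordan_nf A n_as" using jordan_nf_exists_complex[OF A] by blast
  have "0 \<le> spectral_radius A" using spectral_radius_mem_max(1)[OF A n] by auto
  then have r0: "r > 0" using r by simp
  have less: "cmod a < r" if "(m, a) \<in> set n_as" for m a
    using eigenvalue_le_spectral_radius[OF A jordan_nf_eigenvalue[OF A jnf that]] r by simp
  show ?thesis
    by (rule norm_bound_pow_scaled[OF A jnf r0]) (use less in force)+
qed

section \<open>Multiplicities, Jordan block sizes and generalized eigenvectors\<close>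

lemma geom_multiplicity_eq_dim_gen_eigenspace:
  assumes "A \<in> carrier_mat n n"
  shows "geom_multiplicity A e = dim_gen_eigenspace A e 1"
  using assms by (simp add: geom_multiplicity_def dim_gen_eigenspace_def)

text \<open>The algebraic multiplicity adds up the sizes of the blocks for \<open>e\<close>, whereas
  the geometric one counts each nonempty block once.\<close>

lemma alg_eq_geom_multiplicity_iff:
  fixes A :: "'a::field mat"
  assumes A: "A \<in> carrier_mat n n" and jnf: "jordan_nf A n_as"
  shows "alg_multiplicity A e = geom_multiplicity A e \<longleftrightarrow> (\<forall>m. (m, e) \<in> set n_as \<longrightarrow> m \<le> 1)"
proof -
  define ms where "ms = map fst (filter (\<lambda>(n, a). a = e) n_as)"
  have alg: "alg_multiplicity A e = sum_list ms"
    unfolding alg_multiplicity_def jordan_nf_order[OF jnf] ms_def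
    by (simp add: case_prod_unfold)
  have geom: "geom_multiplicity A e = sum_list (map (min 1) ms)"
    unfolding geom_multiplicity_eq_dim_gen_eigenspace[OF A] dim_gen_eigenspace[OF jnf] ms_def ..
  \<comment> \<open>The inequality is carried through the induction so that equality of the sums
    forces equality term by term.\<close>
  have "sum_list (map (min 1) xs) \<le> sum_list xs \<and>
        (sum_list xs = sum_list (map (min 1) xs) \<longleftrightarrow> (\<forall>m\<in>set xs. m \<le> 1))" for xs :: "nat list"
    by (induction xs) auto
  moreover have "set ms = {m. (m, e) \<in> set n_as}" by (force simp: ms_def)
  ultimately show ?thesis unfolding alg geom by blast
qed

lemma norm_bound_pow_semisimple:
  assumes A: "A \<in> carrier_mat n n" and r: "spectral_radius A > 0"
    and ss: "\<And>e. eigenvalue A e \<Longrightarrow> cmod e = spectral_radius A \<Longrightarrow>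
      alg_multiplicity A e = geom_multiplicity A e"
  shows "\<exists>C. \<forall>k. norm_bound (A ^\<^sub>m k) (C * spectral_radius A ^ k)"
proof -
  obtain n_as where jnf: "jordan_nf A n_as" using jordan_nf_exists_complex[OF A] by blast
  note ev = jordan_nf_eigenvalue[OF A jnf]
  show ?thesis
  proof (rule norm_bound_pow_scaled[OF A jnf r])
    fix m a assume mem: "(m, a) \<in> set n_as"
    show "cmod a \<le> spectral_radius A" by (rule eigenvalue_le_spectral_radius[OF A ev[OF mem]])
    show "m \<le> 1" if "cmod a = spectral_radius A"
      using ss[OF ev[OF mem] that] mem alg_eq_geom_multiplicity_iff[OF A jnf] by blast
  qed
qed

lemma generalized_eigenvector_exists:
  fixes A :: "'a::field mat"
  assumes A: "A \<in> carrier_mat n n" and jnf: "jordan_nf A n_as"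
    and ne: "alg_multiplicity A e \<noteq> geom_multiplicity A e"
  obtains v w where "eigenvector A v e" "w \<in> carrier_vec n" "A *\<^sub>v w = e \<cdot>\<^sub>v w + v"
proof -
  let ?B = "char_matrix A e"
  have B: "?B \<in> carrier_mat n n" using A by simp
  then have BB: "?B * ?B \<in> carrier_mat n n" by simp
  define ms where "ms = map fst (filter (\<lambda>(n, a). a = e) n_as)"
  obtain m where m: "(m, e) \<in> set n_as" "m > 1"
    using ne alg_eq_geom_multiplicity_iff[OF A jnf] by auto
  have "set ms = {m. (m, e) \<in> set n_as}" by (force simp: ms_def)
  with m(1) have "m \<in> set ms" by simp
  \<comment> \<open>A block of size at least 2 counts once in the kernel of \<open>?B\<close> but
    twice in the kernel of its square, so the second kernel has larger dimension.\<close>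
  have "sum_list (map (min 1) xs) \<le> sum_list (map (min 2) xs) \<and>
      (m \<in> set xs \<longrightarrow> sum_list (map (min 1) xs) < sum_list (map (min 2) xs))" for xs
    using m(2) by (induction xs) auto
  then have "dim_gen_eigenspace A e 1 \<noteq> dim_gen_eigenspace A e 2"
    unfolding dim_gen_eigenspace[OF jnf] ms_def[symmetric] using \<open>m \<in> set ms\<close> by (metis less_irrefl)
  then have "kernel_dim ?B \<noteq> kernel_dim (?B * ?B)"
    using A by (simp add: dim_gen_eigenspace_def numeral_2_eq_2)
  then have "mat_kernel ?B \<noteq> mat_kernel (?B * ?B)"
    using B BB by (auto simp: kernel_dim_def)
  \<comment> \<open>The kernels are nested and distinct; any \<open>w\<close> in the difference is a
    generalized eigenvector of rank two, and \<open>?B *\<^sub>v w\<close> is the eigenvector below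
    it.\<close>
  with mat_kernel_mult_subset[OF B B] obtain w where w: "w \<in> mat_kernel (?B * ?B)" "w \<notin> mat_kernel ?B"
    by blast
  note wc = mat_kernelD[OF BB w(1)]
  define v where "v = ?B *\<^sub>v w"
  have v: "v \<in> carrier_vec n" using B wc by (simp add: v_def)
  have "v \<noteq> 0\<^sub>v n" using w(2) mat_kernelI[OF B wc(1)] by (auto simp: v_def)
  moreover have "?B *\<^sub>v v = 0\<^sub>v n" using wc B by (simp add: v_def)
  ultimately have "eigenvector A v e" using v eigenvector_char_matrix[OF A] by simp
  moreover have "v = A *\<^sub>v w - e \<cdot>\<^sub>v w"
    unfolding v_def char_matrix_def using A wc(1)
    by (intro eq_vecI) (auto simp: add_mult_distrib_mat_vec[of _ n n])
  then have "A *\<^sub>v w = e \<cdot>\<^sub>v w + v" using A wc(1) by auto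
  ultimately show ?thesis using that wc(1) by blast
qed

text \<open>Both sides carry an extra factor \<open>e\<close>, which avoids the exponent \<open>k - 1\<close>.\<close>

lemma pow_mult_generalized_eigenvector:
  fixes A :: "'a::field mat"
  assumes A: "A \<in> carrier_mat n n" and v: "eigenvector A v e"
    and w: "w \<in> carrier_vec n" and Aw: "A *\<^sub>v w = e \<cdot>\<^sub>v w + v"
  shows "e \<cdot>\<^sub>v (A ^\<^sub>m k *\<^sub>v w) = e ^ k \<cdot>\<^sub>v (e \<cdot>\<^sub>v w + of_nat k \<cdot>\<^sub>v v)"
proof (induction k)
  case 0
  show ?case using A w v by (auto simp: eigenvector_def)
next
  case (Suc k)
  have vc: "v \<in> carrier_vec n" using v A by (simp add: eigenvector_def)
  have Ak: "A ^\<^sub>m k \<in> carrier_mat n n" using A by simp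
  have "A ^\<^sub>m Suc k *\<^sub>v w = A ^\<^sub>m k *\<^sub>v (e \<cdot>\<^sub>v w + v)"
    by (simp add: assoc_mult_mat_vec[OF Ak A w] Aw)
  also have "\<dots> = e \<cdot>\<^sub>v (A ^\<^sub>m k *\<^sub>v w) + A ^\<^sub>m k *\<^sub>v v"
    using Ak w vc by (simp add: mult_add_distrib_mat_vec[of _ n n] mult_mat_vec)
  also have "\<dots> = e ^ k \<cdot>\<^sub>v (e \<cdot>\<^sub>v w + of_nat k \<cdot>\<^sub>v v) + e ^ k \<cdot>\<^sub>v v"
    unfolding Suc.IH eigenvector_pow[OF A v] ..
  finally show ?case
    using w vc by (auto simp: algebra_simps)
qed

section \<open>Lower bounds for matrix powers from eigenvectors\<close>

lemma norm_mult_mat_vec_le: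
  fixes M :: "'a::real_normed_field mat"
  assumes M: "M \<in> carrier_mat m n" and b: "norm_bound M b" and w: "w \<in> carrier_vec n" and i: "i < m"
  shows "norm ((M *\<^sub>v w) $ i) \<le> b * (\<Sum>j<n. norm (w $ j))"
proof -
  have "(M *\<^sub>v w) $ i = (\<Sum>j<n. M $$ (i, j) * w $ j)"
    using M w i by (simp add: scalar_prod_def atLeast0LessThan)
  also have "norm \<dots> \<le> (\<Sum>j<n. b * norm (w $ j))"
    using M b i unfolding norm_bound_def
    by (intro sum_norm_le) (auto simp: norm_mult intro!: mult_right_mono)
  finally show ?thesis by (simp add: sum_distrib_left)
qed

lemma eigenvector_nonzero_entry:
  assumes A: "A \<in> carrier_mat n n" and v: "eigenvector A v e"
  obtains i where "i < n" "v $ i \<noteq> 0"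
proof -
  have "v \<in> carrier_vec n" "v \<noteq> 0\<^sub>v n" using assms by (auto simp: eigenvector_def)
  then have "\<exists>i<n. v $ i \<noteq> 0" by (auto intro!: eq_vecI)
  then show ?thesis using that by blast
qed

text \<open>An entrywise bound on \<open>A ^\<^sub>m k\<close> limits the entries of its action on
  an eigenvector, which is scaling by \<open>e ^ k\<close>. Comparing at a nonzero coordinate gives
  \<open>c\<close> as the ratio of that coordinate to the sum of all moduli.\<close>

lemma norm_bound_pow_ge:
  fixes A :: "complex mat"
  assumes A: "A \<in> carrier_mat n n" and e: "eigenvalue A e"
  shows "\<exists>c>0. \<forall>k b. norm_bound (A ^\<^sub>m k) b \<longrightarrow> c * cmod e ^ k \<le> b"
proof -
  from e obtain v where v: "eigenvector A v e" by (auto simp: eigenvalue_def)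
  then have vc: "v \<in> carrier_vec n" using A by (simp add: eigenvector_def)
  obtain i where i: "i < n" "v $ i \<noteq> 0" using eigenvector_nonzero_entry[OF A v] .
  define V where "V = (\<Sum>j<n. cmod (v $ j))"
  have "cmod (v $ i) \<le> V" unfolding V_def using i by (intro member_le_sum) auto
  then have V: "V > 0" using i by (smt (verit) zero_less_norm_iff)
  have "cmod (v $ i) / V * cmod e ^ k \<le> b" if "norm_bound (A ^\<^sub>m k) b" for k b
  proof -
    have "cmod ((A ^\<^sub>m k *\<^sub>v v) $ i) \<le> b * V"
      unfolding V_def by (rule norm_mult_mat_vec_le[OF _ that vc i(1)]) (use A in simp)
    then have "cmod e ^ k * cmod (v $ i) \<le> b * V"
      unfolding eigenvector_pow[OF A v] using i vc by (simp add: norm_mult norm_power)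
    then show ?thesis using V by (simp add: field_simps)
  qed
  moreover have "cmod (v $ i) / V > 0" using i V by simp
  ultimately show ?thesis by blast
qed

text \<open>Applied to a generalized eigenvector \<open>w\<close>, the powers pick up a term that is
  linear in \<open>k\<close> along \<open>v\<close>. At a coordinate where \<open>v\<close> is
  nonzero this term dominates, and \<open>d\<close> absorbs the contribution of \<open>w\<close>
  itself.\<close>

lemma norm_bound_pow_ge_defective:
  fixes A :: "complex mat"
  assumes A: "A \<in> carrier_mat n n" and e: "e \<noteq> 0"
    and ne: "alg_multiplicity A e \<noteq> geom_multiplicity A e"
  shows "\<exists>c>0. \<exists>d. \<forall>k b. norm_bound (A ^\<^sub>m k) b \<longrightarrow> (c * real k - d) * cmod e ^ k \<le> b"
proof -
  obtain n_as where jnf: "jordan_nf A n_as" using jordan_nf_exists_complex[OF A] by blast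
  obtain v w where v: "eigenvector A v e" and w: "w \<in> carrier_vec n"
    and Aw: "A *\<^sub>v w = e \<cdot>\<^sub>v w + v"
    using generalized_eigenvector_exists[OF A jnf ne] .
  have vc: "v \<in> carrier_vec n" using A v by (simp add: eigenvector_def)
  obtain i where i: "i < n" "v $ i \<noteq> 0" using eigenvector_nonzero_entry[OF A v] .
  \<comment> \<open>The summand 1 makes the later divisor \<open>W\<close> positive at once.\<close>
  define W where "W = 1 + (\<Sum>j<n. cmod (w $ j))"
  have W: "W > 0" unfolding W_def by (smt (verit) sum_nonneg norm_ge_zero)
  \<comment> \<open>Both constants come from dividing the lower bound
    \<open>real k * cmod (v $ i) - cmod e * cmod (w $ i)\<close> by
    \<open>cmod e * W\<close>.\<close>
  define c where "c = cmod (v $ i) / (cmod e * W)"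
  define d where "d = cmod (w $ i) / W"
  have "(c * real k - d) * cmod e ^ k \<le> b" if b: "norm_bound (A ^\<^sub>m k) b" for k b
  proof -
    \<comment> \<open>Any entry shows that \<open>b\<close> is non-negative, which is needed to
      enlarge the sum of the moduli of \<open>w\<close> to \<open>W\<close> under the factor
      \<open>b\<close>.\<close>
    have "cmod ((A ^\<^sub>m k) $$ (i, i)) \<le> b" using b i A by (simp add: norm_bound_def)
    then have b0: "b \<ge> 0" using norm_ge_zero order_trans by blast
    have "cmod e ^ k * (real k * cmod (v $ i) - cmod e * cmod (w $ i))
        \<le> cmod e ^ k * cmod (e * w $ i + of_nat k * v $ i)"
      using norm_diff_ineq[of "of_nat k * v $ i" "e * w $ i"]
      by (intro mult_left_mono) (auto simp: norm_mult add.commute)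
    also have "\<dots> = cmod ((e ^ k \<cdot>\<^sub>v (e \<cdot>\<^sub>v w + of_nat k \<cdot>\<^sub>v v)) $ i)"
      using i w vc by (simp add: norm_mult norm_power)
    also have "\<dots> = cmod ((e \<cdot>\<^sub>v (A ^\<^sub>m k *\<^sub>v w)) $ i)"
      unfolding pow_mult_generalized_eigenvector[OF A v w Aw] ..
    also have "\<dots> = cmod e * cmod ((A ^\<^sub>m k *\<^sub>v w) $ i)"
      using i A by (simp add: norm_mult)
    also have "\<dots> \<le> cmod e * (b * (\<Sum>j<n. cmod (w $ j)))"
      by (intro mult_left_mono norm_mult_mat_vec_le[OF _ b w i(1)]) (use A in auto)
    also have "\<dots> \<le> cmod e * (b * W)"
      unfolding W_def using b0 by (intro mult_left_mono) auto
    finally show ?thesis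
      using W e unfolding c_def d_def by (simp add: field_simps)
  qed
  moreover have "c > 0" unfolding c_def using i W e by simp
  ultimately show ?thesis by blast
qed

subsection \<open>The Tucker product\<close>

lemma finite_multi_index [simp]: "finite (multi_index N J)"
  unfolding multi_index_def by (intro finite_PiE) auto

lemma multi_index_less: "i \<in> multi_index N J \<Longrightarrow> n \<in> {1..N} \<Longrightarrow> i n < J n"
  unfolding multi_index_def by (auto simp: PiE_iff)

lemma tensor_norm_eq_L2_set: "tensor_norm N J X = L2_set X (multi_index N J)"
  by (simp add: tensor_norm_def L2_set_def)

lemma tensor_norm_nonneg: "tensor_norm N J X \<ge> 0"
  by (simp add: tensor_norm_eq_L2_set L2_set_nonneg)

lemma abs_entry_le_tensor_norm:
  assumes "i \<in> multi_index N J"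
  shows "\<bar>X i\<bar> \<le> tensor_norm N J X"
proof -
  have "\<bar>X i\<bar> \<le> L2_set (\<lambda>i. \<bar>X i\<bar>) (multi_index N J)"
    using assms by (intro member_le_L2_set) auto
  then show ?thesis by (simp add: tensor_norm_eq_L2_set L2_set_def)
qed

section \<open>Composition and identity for Tucker products\<close>

lemma mult_pow_mat:
  assumes A: "A \<in> carrier_mat n n"
  shows "A * A ^\<^sub>m k = A ^\<^sub>m Suc k"
proof (induction k)
  case (Suc k)
  have "A * (A ^\<^sub>m k * A) = A * A ^\<^sub>m k * A"
    by (rule assoc_mult_mat[symmetric]) (use A in auto)
  with Suc show ?case by simp
qed (use A in simp)

text \<open>After exchanging the two sums, the inner sum over all multi-indices of a product over
  modes factors by distributivity into a product of single sums, each of which is an entry of a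
  matrix product. The matrices applied second stand on the left.\<close>

lemma tucker_product_mult:
  assumes M: "\<And>n. n \<in> {1..N} \<Longrightarrow> M n \<in> carrier_mat (J n) (J n)"
    and L: "\<And>n. n \<in> {1..N} \<Longrightarrow> L n \<in> carrier_mat (J n) (J n)"
  shows "tucker_product N J (tucker_product N J X M) L = tucker_product N J X (\<lambda>n. L n * M n)"
proof
  fix i
  let ?I = "multi_index N J"
  show "tucker_product N J (tucker_product N J X M) L i = tucker_product N J X (\<lambda>n. L n * M n) i"
  proof (cases "i \<in> ?I")
    case i: True
    have entry: "(\<Sum>j\<in>?I. \<Prod>n=1..N. L n $$ (i n, j n) * M n $$ (j n, k n)) =
        (\<Prod>n=1..N. (L n * M n) $$ (i n, k n))" if k: "k \<in> ?I" for k
    proof -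
      have "(\<Sum>j\<in>?I. \<Prod>n=1..N. L n $$ (i n, j n) * M n $$ (j n, k n)) =
          (\<Prod>n=1..N. \<Sum>j<J n. L n $$ (i n, j) * M n $$ (j, k n))"
        unfolding multi_index_def by (rule prod_sum_PiE[symmetric]) auto
      also have "\<dots> = (\<Prod>n=1..N. (L n * M n) $$ (i n, k n))"
      proof (rule prod.cong[OF refl])
        fix n assume n: "n \<in> {1..N}"
        show "(\<Sum>j<J n. L n $$ (i n, j) * M n $$ (j, k n)) = (L n * M n) $$ (i n, k n)"
          using M[OF n] L[OF n] multi_index_less[OF i n] multi_index_less[OF k n]
          by (simp add: scalar_prod_def atLeast0LessThan)
      qed
      finally show ?thesis .
    qed
    have "tucker_product N J (tucker_product N J X M) L i =
        (\<Sum>j\<in>?I. \<Sum>k\<in>?I. X k * (\<Prod>n=1..N. L n $$ (i n, j n) * M n $$ (j n, k n)))"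
      using i by (simp add: tucker_product_def sum_distrib_left prod.distrib mult_ac)
    also have "\<dots> = (\<Sum>k\<in>?I. X k * (\<Sum>j\<in>?I. \<Prod>n=1..N. L n $$ (i n, j n) * M n $$ (j n, k n)))"
      by (subst sum.swap) (simp add: sum_distrib_left)
    also have "\<dots> = tucker_product N J X (\<lambda>n. L n * M n) i"
      unfolding tucker_product_def if_P[OF i] by (intro sum.cong refl) (simp only: entry)
    finally show ?thesis .
  qed (simp add: tucker_product_def)
qed

lemma tucker_product_one:
  assumes X: "X \<in> tensors N J"
  shows "tucker_product N J X (\<lambda>n. 1\<^sub>m (J n)) = X"
proof
  fix i
  let ?I = "multi_index N J"
  show "tucker_product N J X (\<lambda>n. 1\<^sub>m (J n)) i = X i"
  proof (cases "i \<in> ?I")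
    case i: True
    have delta: "(\<Prod>n=1..N. 1\<^sub>m (J n) $$ (i n, j n)) = (if j = i then 1 else (0::real))"
      if j: "j \<in> ?I" for j
    proof (cases "j = i")
      case True
      then show ?thesis using multi_index_less[OF i] by (auto intro!: prod.neutral)
    next
      case False
      \<comment> \<open>Multi-indices are extensional outside the modes, so two distinct ones
        already differ at some mode.\<close>
      then obtain n where n: "n \<in> {1..N}" "j n \<noteq> i n"
        using PiE_ext i j unfolding multi_index_def by blast
      then have "1\<^sub>m (J n) $$ (i n, j n) = (0::real)"
        using multi_index_less[OF i n(1)] multi_index_less[OF j n(1)] by auto
      then show ?thesis using n False by (auto intro!: prod_zero)
    qed
    have "tucker_product N J X (\<lambda>n. 1\<^sub>m (J n)) i = (\<Sum>j\<in>?I. X j * (if j = i then 1 else 0))"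
      unfolding tucker_product_def if_P[OF i] by (intro sum.cong refl) (simp only: delta)
    then show ?thesis using i by (simp add: if_distrib cong: if_cong)
  next
    case False
    then show ?thesis using X by (simp add: tucker_product_def tensors_def)
  qed
qed

section \<open>Trajectories and upper bounds on their norms\<close>

lemma tucker_product_cong:
  "(\<And>n. n \<in> {1..N} \<Longrightarrow> M n = L n) \<Longrightarrow> tucker_product N J X M = tucker_product N J X L"
  unfolding tucker_product_def by (intro ext) (auto intro!: sum.cong prod.cong)

lemma mlti_trajectory_eq:
  assumes A: "\<And>n. n \<in> {1..N} \<Longrightarrow> A n \<in> carrier_mat (J n) (J n)"
    and X: "mlti_trajectory N J A X"
  shows "X t = tucker_product N J (X 0) (\<lambda>n. A n ^\<^sub>m t)"
proof (induction t)
  case 0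
  \<comment> \<open>The zeroth power is the identity of size \<open>dim_row (A n)\<close>, which is
    known to be \<open>J n\<close> only at the modes; hence the congruence rule.\<close>
  have "tucker_product N J (X 0) (\<lambda>n. A n ^\<^sub>m 0) = tucker_product N J (X 0) (\<lambda>n. 1\<^sub>m (J n))"
    using A by (intro tucker_product_cong) (metis carrier_matD(1) pow_mat.simps(1))
  then show ?case using X by (simp add: mlti_trajectory_def tucker_product_one)
next
  case (Suc t)
  \<comment> \<open>A time step multiplies by \<open>A n\<close> on the left, while
    \<open>pow_mat\<close> appends factors on the right.\<close>
  have comm: "A n * A n ^\<^sub>m t = A n ^\<^sub>m Suc t" if "n \<in> {1..N}" for n
    by (rule mult_pow_mat[OF A[OF that]])
  have "X (Suc t) = tucker_product N J (tucker_product N J (X 0) (\<lambda>n. A n ^\<^sub>m t)) A"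
    using X Suc by (simp add: mlti_trajectory_def)
  also have "\<dots> = tucker_product N J (X 0) (\<lambda>n. A n * A n ^\<^sub>m t)"
    by (rule tucker_product_mult) (use A in auto)
  also have "\<dots> = tucker_product N J (X 0) (\<lambda>n. A n ^\<^sub>m Suc t)"
    by (rule tucker_product_cong) (rule comm)
  finally show ?case .
qed

lemma mlti_trajectory_exists:
  assumes "X0 \<in> tensors N J"
  obtains X where "mlti_trajectory N J A X" "X 0 = X0"
  using that[of "rec_nat X0 (\<lambda>_ Y. tucker_product N J Y A)"] assms by (simp add: mlti_trajectory_def)

text \<open>A crude constant suffices: one factor \<open>card (multi_index N J)\<close> comes from
  the sum over \<open>j\<close> in each entry, the other from bounding the Frobenius norm by the sum
  of the absolute entries.\<close>

lemma tensor_norm_tucker_product_le: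
  assumes M: "\<And>n. n \<in> {1..N} \<Longrightarrow> M n \<in> carrier_mat (J n) (J n)"
    and b: "\<And>n. n \<in> {1..N} \<Longrightarrow> norm_bound (M n) (b n)"
  shows "tensor_norm N J (tucker_product N J X M) \<le>
    (real (card (multi_index N J)))\<^sup>2 * (\<Prod>n=1..N. b n) * tensor_norm N J X"
proof -
  let ?I = "multi_index N J"
  have entry: "\<bar>\<Prod>n=1..N. M n $$ (i n, j n)\<bar> \<le> (\<Prod>n=1..N. b n)" if "i \<in> ?I" "j \<in> ?I" for i j
    unfolding abs_prod
  proof (rule prod_mono)
    fix n assume n: "n \<in> {1..N}"
    show "0 \<le> \<bar>M n $$ (i n, j n)\<bar> \<and> \<bar>M n $$ (i n, j n)\<bar> \<le> b n"
      using b[OF n] M[OF n] multi_index_less[OF that(1) n] multi_index_less[OF that(2) n]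
      by (simp add: norm_bound_def)
  qed
  have "\<bar>tucker_product N J X M i\<bar> \<le> real (card ?I) * (tensor_norm N J X * (\<Prod>n=1..N. b n))"
    if i: "i \<in> ?I" for i
  proof -
    have "\<bar>tucker_product N J X M i\<bar> \<le> (\<Sum>j\<in>?I. \<bar>X j * (\<Prod>n=1..N. M n $$ (i n, j n))\<bar>)"
      using i by (simp add: tucker_product_def sum_abs)
    also have "\<dots> \<le> (\<Sum>j\<in>?I. tensor_norm N J X * (\<Prod>n=1..N. b n))"
      unfolding abs_mult
      by (intro sum_mono mult_mono abs_entry_le_tensor_norm entry i tensor_norm_nonneg) auto
    finally show ?thesis by simp
  qed
  then have "(\<Sum>i\<in>?I. \<bar>tucker_product N J X M i\<bar>)
      \<le> real (card ?I) * (real (card ?I) * (tensor_norm N J X * (\<Prod>n=1..N. b n)))"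
    by (rule sum_bounded_above)
  with L2_set_le_sum_abs[of "tucker_product N J X M" ?I] show ?thesis
    by (simp add: tensor_norm_eq_L2_set power2_eq_square mult_ac)
qed

lemma mlti_trajectory_norm_bound:
  assumes A: "\<And>n. n \<in> {1..N} \<Longrightarrow> A n \<in> carrier_mat (J n) (J n)"
    and b: "\<And>n. n \<in> {1..N} \<Longrightarrow> \<exists>C. \<forall>t. norm_bound (A n ^\<^sub>m t) (C * r n ^ t)"
  shows "\<exists>K>0. \<forall>X t. mlti_trajectory N J A X \<longrightarrow>
    tensor_norm N J (X t) \<le> K * \<bar>\<Prod>n=1..N. r n\<bar> ^ t * tensor_norm N J (X 0)"
proof -
  obtain C where C: "\<And>n t. n \<in> {1..N} \<Longrightarrow> norm_bound (A n ^\<^sub>m t) (C n * r n ^ t)"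
    using b by metis
  define K where "K = (real (card (multi_index N J)))\<^sup>2 * (\<Prod>n=1..N. C n)"
  \<comment> \<open>No sign is assumed for \<open>C\<close> or \<open>r\<close>, hence the absolute
    values; adding 1 makes the constant strictly positive.\<close>
  have "tensor_norm N J (X t) \<le> (\<bar>K\<bar> + 1) * \<bar>\<Prod>n=1..N. r n\<bar> ^ t * tensor_norm N J (X 0)"
    if X: "mlti_trajectory N J A X" for X t
  proof -
    have Xt: "X t = tucker_product N J (X 0) (\<lambda>n. A n ^\<^sub>m t)"
      by (rule mlti_trajectory_eq[OF A X])
    have "tensor_norm N J (X t) \<le> K * (\<Prod>n=1..N. r n) ^ t * tensor_norm N J (X 0)"
      unfolding Xt K_def
      using tensor_norm_tucker_product_le[of N "\<lambda>n. A n ^\<^sub>m t" J "\<lambda>n. C n * r n ^ t" "X 0"] A C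
      by (simp add: prod.distrib prod_power_distrib mult.assoc)
    also have "K * (\<Prod>n=1..N. r n) ^ t \<le> \<bar>K * (\<Prod>n=1..N. r n) ^ t\<bar>" by simp
    also have "\<dots> \<le> (\<bar>K\<bar> + 1) * \<bar>\<Prod>n=1..N. r n\<bar> ^ t"
      by (simp add: abs_mult power_abs distrib_right)
    finally show ?thesis by (simp add: mult_right_mono tensor_norm_nonneg)
  qed
  then show ?thesis by (intro exI[of _ "\<bar>K\<bar> + 1"]) auto
qed

section \<open>Bounds on matrix powers forced by stability\<close>

lemma mlti_stable_imp_prod_entries_bounded:
  assumes A: "\<And>n. n \<in> {1..N} \<Longrightarrow> A n \<in> carrier_mat (J n) (J n)"
    and st: "mlti_stable N J A"
  shows "\<exists>\<gamma>>0. \<forall>t. \<forall>i\<in>multi_index N J. \<forall>j\<in>multi_index N J.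
    \<bar>\<Prod>n=1..N. (A n ^\<^sub>m t) $$ (i n, j n)\<bar> \<le> \<gamma>"
proof -
  let ?I = "multi_index N J"
  obtain \<gamma> where \<gamma>: "\<gamma> > 0"
    "\<And>X t. mlti_trajectory N J A X \<Longrightarrow> tensor_norm N J (X t) \<le> \<gamma> * tensor_norm N J (X 0)"
    using st unfolding mlti_stable_def by blast
  have "\<bar>\<Prod>n=1..N. (A n ^\<^sub>m t) $$ (i n, j n)\<bar> \<le> \<gamma>" if i: "i \<in> ?I" and j: "j \<in> ?I" for t i j
  proof -
    \<comment> \<open>Starting from the unit tensor at \<open>j\<close> isolates a single product of
      matrix entries, and its norm is 1.\<close>
    define E :: tensor where "E = (\<lambda>k. if k = j then 1 else 0)"
    have "E \<in> tensors N J" using j by (auto simp: E_def tensors_def)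
    then obtain X where X: "mlti_trajectory N J A X" "X 0 = E" by (rule mlti_trajectory_exists)
    have Xt: "X t = tucker_product N J E (\<lambda>n. A n ^\<^sub>m t)"
      using mlti_trajectory_eq[OF A X(1)] X(2) by simp
    have "tensor_norm N J E = 1"
      using j by (simp add: tensor_norm_def E_def if_distrib[of "\<lambda>x. x\<^sup>2"] cong: if_cong)
    moreover have "X t i = (\<Prod>n=1..N. (A n ^\<^sub>m t) $$ (i n, j n))"
      unfolding Xt using i j by (simp add: tucker_product_def E_def if_distrib[of "\<lambda>x. x * _"] cong: if_cong)
    ultimately show ?thesis
      using \<gamma>(2)[OF X(1), of t] X(2) abs_entry_le_tensor_norm[OF i, of "X t"] by simp
  qed
  with \<gamma>(1) show ?thesis by blast
qed

lemma norm_bound_attained: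
  fixes M :: "'a::real_normed_field mat"
  assumes M: "M \<in> carrier_mat m n" and "m > 0" "n > 0"
  shows "\<exists>i<m. \<exists>j<n. norm_bound M (norm (M $$ (i, j)))"
proof -
  let ?S = "{norm (M $$ (i, j)) |i j. i < dim_row M \<and> j < dim_col M}"
  have "finite ?S" by (simp add: finite_image_set2)
  moreover have "norm (M $$ (0, 0)) \<in> ?S" using assms by auto
  ultimately have "Max ?S \<in> ?S" by (intro Max_in) auto
  then obtain i j where "i < m" "j < n" "Max ?S = norm (M $$ (i, j))" using M by auto
  with norm_bound_max[of M] show ?thesis by metis
qed

text \<open>Choosing an entry of largest modulus in each mode independently defines one pair of
  multi-indices, so the product of the maxima is itself one of the bounded products. The bounds
  \<open>b\<close> vary with \<open>t\<close>, but \<open>\<gamma>\<close> does not.\<close>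

lemma mlti_stable_imp_prod_norm_bounds:
  assumes J: "\<And>n. n \<in> {1..N} \<Longrightarrow> J n \<ge> 1"
    and A: "\<And>n. n \<in> {1..N} \<Longrightarrow> A n \<in> carrier_mat (J n) (J n)"
    and st: "mlti_stable N J A"
  shows "\<exists>\<gamma>>0. \<forall>t. \<exists>b. (\<forall>n\<in>{1..N}. norm_bound (A n ^\<^sub>m t) (b n)) \<and> (\<Prod>n=1..N. b n) \<le> \<gamma>"
proof -
  obtain \<gamma> where \<gamma>: "\<gamma> > 0" "\<And>t i j. i \<in> multi_index N J \<Longrightarrow> j \<in> multi_index N J \<Longrightarrow>
      \<bar>\<Prod>n=1..N. (A n ^\<^sub>m t) $$ (i n, j n)\<bar> \<le> \<gamma>"
    using mlti_stable_imp_prod_entries_bounded[OF A st] by blast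
  have "\<exists>b. (\<forall>n\<in>{1..N}. norm_bound (A n ^\<^sub>m t) (b n)) \<and> (\<Prod>n=1..N. b n) \<le> \<gamma>" for t
  proof -
    have "\<exists>i j. i < J n \<and> j < J n \<and> norm_bound (A n ^\<^sub>m t) (norm ((A n ^\<^sub>m t) $$ (i, j)))"
      if n: "n \<in> {1..N}" for n
      using norm_bound_attained[of "A n ^\<^sub>m t" "J n" "J n"] A[OF n] J[OF n] by auto
    then obtain i j where ij: "\<And>n. n \<in> {1..N} \<Longrightarrow> i n < J n \<and> j n < J n \<and>
        norm_bound (A n ^\<^sub>m t) (norm ((A n ^\<^sub>m t) $$ (i n, j n)))"
      by metis
    \<comment> \<open>Restriction makes the chosen indices extensional, as membership in
      \<open>multi_index\<close> demands.\<close>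
    let ?i = "restrict i {1..N}" and ?j = "restrict j {1..N}"
    have "?i \<in> multi_index N J" "?j \<in> multi_index N J"
      using ij by (auto simp: multi_index_def)
    from \<gamma>(2)[OF this, of t] have "(\<Prod>n=1..N. \<bar>(A n ^\<^sub>m t) $$ (i n, j n)\<bar>) \<le> \<gamma>"
      by (simp add: abs_prod)
    with ij show ?thesis
      by (intro exI[of _ "\<lambda>n. \<bar>(A n ^\<^sub>m t) $$ (i n, j n)\<bar>"]) auto
  qed
  with \<gamma>(1) show ?thesis by blast
qed

subsection \<open>Stability of multilinear time-invariant systems\<close>

text \<open>This carries growth estimates from complex spectral theory over to the real matrices of
  the system, since the embedding respects powers and moduli.\<close>

lemma norm_bound_complexify_pow:
  assumes "M \<in> carrier_mat n n"
  shows "norm_bound (complexify M ^\<^sub>m t) b \<longleftrightarrow> norm_bound (M ^\<^sub>m t) b"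
  unfolding of_real_hom.mat_hom_pow[OF assms, symmetric] by (simp add: norm_bound_def)

theorem proposition6p7:
  fixes N :: nat and J :: "nat \<Rightarrow> nat"
    and A :: "nat \<Rightarrow> real mat" and \<rho> :: "nat \<Rightarrow> real"
  assumes "N \<ge> 1"
    and "\<And>n. n \<in> {1..N} \<Longrightarrow> J n \<ge> 1"
    and "\<And>n. n \<in> {1..N} \<Longrightarrow> A n \<in> carrier_mat (J n) (J n)"
    and "\<And>n. n \<in> {1..N} \<Longrightarrow> \<rho> n = spectral_radius (complexify (A n))"
  shows "(mlti_stable N J A \<longleftrightarrow>
            (\<Prod>n=1..N. \<rho> n) \<le> 1 \<and>
            ((\<Prod>n=1..N. \<rho> n) = 1 \<longrightarrow>
              (\<forall>n\<in>{1..N}. \<forall>e. eigenvalue (complexify (A n)) e \<and> cmod e = \<rho> n \<longrightarrow>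
                 alg_multiplicity (complexify (A n)) e = geom_multiplicity (complexify (A n)) e)))
       \<and> ((\<Prod>n=1..N. \<rho> n) < 1 \<longrightarrow> mlti_asymptotically_stable N J A)
       \<and> ((\<Prod>n=1..N. \<rho> n) > 1 \<longrightarrow> mlti_unstable N J A)"
proof -
  note J = assms(2) and A = assms(3) and \<rho> = assms(4)
  define P where "P = (\<Prod>n=1..N. \<rho> n)"
  define semisimple where "semisimple \<longleftrightarrow> (\<forall>n\<in>{1..N}. \<forall>e.
    eigenvalue (complexify (A n)) e \<and> cmod e = \<rho> n \<longrightarrow>
    alg_multiplicity (complexify (A n)) e = geom_multiplicity (complexify (A n)) e)"
  have cA: "complexify (A n) \<in> carrier_mat (J n) (J n)" if "n \<in> {1..N}" for n
    using A[OF that] by simp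
  have J0: "J n > 0" if "n \<in> {1..N}" for n
    using J[OF that] by simp
  have dominant: "\<exists>e. eigenvalue (complexify (A n)) e \<and> cmod e = \<rho> n" if n: "n \<in> {1..N}" for n
    using spectral_radius_mem_max(1)[OF cA[OF n] J0[OF n]] \<rho>[OF n] by (auto simp: spectrum_def)
  then have \<rho>0: "\<rho> n \<ge> 0" if "n \<in> {1..N}" for n
    using that norm_ge_zero by metis

  have decay: "\<exists>K>0. \<exists>q. 0 \<le> q \<and> q < 1 \<and> (\<forall>X t. mlti_trajectory N J A X \<longrightarrow>
      tensor_norm N J (X t) \<le> K * q ^ t * tensor_norm N J (X 0))" if P: "P < 1"
  proof -
    \<comment> \<open>The product is continuous in a common slack \<epsilon> and is below 1 at 0, so
      some positive \<epsilon> keeps it below 1. The slack absorbs nontrivial Jordan blocks and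
      vanishing spectral radii; the resulting product is the rate \<open>q\<close>.\<close>
    have "((\<lambda>\<epsilon>. \<Prod>n=1..N. \<rho> n + \<epsilon>) \<longlongrightarrow> (\<Prod>n=1..N. \<rho> n + 0)) (at_right 0)"
      by (intro tendsto_intros)
    then have "\<forall>\<^sub>F \<epsilon> in at_right 0. (\<Prod>n=1..N. \<rho> n + \<epsilon>) < 1"
      using P by (intro order_tendstoD(2)) (auto simp: P_def)
    then have "\<forall>\<^sub>F \<epsilon> in at_right 0. (\<Prod>n=1..N. \<rho> n + \<epsilon>) < 1 \<and> \<epsilon> > 0"
      using eventually_at_right_less by (rule eventually_conj)
    then obtain \<epsilon> where \<epsilon>: "(\<Prod>n=1..N. \<rho> n + \<epsilon>) < 1" "\<epsilon> > 0"
      using eventually_happens'[OF trivial_limit_at_right_real] by blast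
    have nonneg: "0 \<le> (\<Prod>n=1..N. \<rho> n + \<epsilon>)"
      by (intro prod_nonneg) (use \<rho>0 \<epsilon> in force)
    have "\<exists>C. \<forall>t. norm_bound (A n ^\<^sub>m t) (C * (\<rho> n + \<epsilon>) ^ t)" if n: "n \<in> {1..N}" for n
      using norm_bound_pow_gt_spectral_radius[OF cA[OF n] J0[OF n], of "\<rho> n + \<epsilon>"] \<rho>[OF n] \<epsilon>(2)
      by (simp add: norm_bound_complexify_pow[OF A[OF n]])
    then have "\<exists>K>0. \<forall>X t. mlti_trajectory N J A X \<longrightarrow>
        tensor_norm N J (X t) \<le> K * \<bar>\<Prod>n=1..N. \<rho> n + \<epsilon>\<bar> ^ t * tensor_norm N J (X 0)"
      by (intro mlti_trajectory_norm_bound A)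
    then show ?thesis
      unfolding abs_of_nonneg[OF nonneg] using nonneg \<epsilon>(1) by blast
  qed

  have stable_lt: "mlti_stable N J A" if P: "P < 1"
  proof -
    obtain K q where K: "K > 0" "0 \<le> q" "q < 1" "\<And>X t. mlti_trajectory N J A X \<Longrightarrow>
        tensor_norm N J (X t) \<le> K * q ^ t * tensor_norm N J (X 0)"
      using decay[OF P] by blast
    have "tensor_norm N J (X t) \<le> K * tensor_norm N J (X 0)" if X: "mlti_trajectory N J A X" for X t
    proof -
      have "K * q ^ t \<le> K" using K by (simp add: mult_left_le power_le_one)
      then show ?thesis
        using K(4)[OF X, of t] mult_right_mono[OF _ tensor_norm_nonneg] order_trans by blast
    qed
    with K(1) show ?thesis unfolding mlti_stable_def by blast
  qed

  have stable_eq: "mlti_stable N J A" if P: "P = 1" and ss: "semisimple"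
  proof -
    have "\<exists>C. \<forall>t. norm_bound (A n ^\<^sub>m t) (C * \<rho> n ^ t)" if n: "n \<in> {1..N}" for n
    proof -
      \<comment> \<open>A product equal to 1 has no zero factor, so scaling by every spectral radius
        is possible.\<close>
      have "\<rho> n \<noteq> 0" using P n unfolding P_def by (metis finite_atLeastAtMost prod_zero_iff zero_neq_one)
      then have "\<rho> n > 0" using \<rho>0[OF n] by simp
      then show ?thesis
        using norm_bound_pow_semisimple[OF cA[OF n]] ss n \<rho>[OF n]
        by (simp add: norm_bound_complexify_pow[OF A[OF n]] semisimple_def)
    qed
    then have "\<exists>K>0. \<forall>X t. mlti_trajectory N J A X \<longrightarrow>
        tensor_norm N J (X t) \<le> K * \<bar>\<Prod>n=1..N. \<rho> n\<bar> ^ t * tensor_norm N J (X 0)"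
      by (intro mlti_trajectory_norm_bound A)
    then show ?thesis
      unfolding mlti_stable_def P_def[symmetric] P by simp
  qed

  have asymp: "mlti_asymptotically_stable N J A" if P: "P < 1"
    unfolding mlti_asymptotically_stable_def
  proof (intro allI impI)
    fix X assume X: "mlti_trajectory N J A X"
    obtain K q where K: "0 \<le> q" "q < 1" "\<And>X t. mlti_trajectory N J A X \<Longrightarrow>
        tensor_norm N J (X t) \<le> K * q ^ t * tensor_norm N J (X 0)"
      using decay[OF P] by blast
    have "(\<lambda>t. K * q ^ t * tensor_norm N J (X 0)) \<longlonglongrightarrow> K * 0 * tensor_norm N J (X 0)"
      using K by (intro tendsto_intros LIMSEQ_realpow_zero)
    then have lim: "(\<lambda>t. K * q ^ t * tensor_norm N J (X 0)) \<longlonglongrightarrow> 0" by simp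
    show "(\<lambda>t. tensor_norm N J (X t)) \<longlonglongrightarrow> 0"
      by (rule tendsto_sandwich[OF _ _ tendsto_const lim])
        (simp_all only: K(3)[OF X] tensor_norm_nonneg eventually_True)
  qed

  have "\<exists>c>0. \<forall>t b. norm_bound (A n ^\<^sub>m t) b \<longrightarrow> c * \<rho> n ^ t \<le> b" if n: "n \<in> {1..N}" for n
  proof -
    obtain e where e: "eigenvalue (complexify (A n)) e" "cmod e = \<rho> n" using dominant[OF n] by blast
    show ?thesis
      using norm_bound_pow_ge[OF cA[OF n] e(1)]
      unfolding norm_bound_complexify_pow[OF A[OF n]] e(2) .
  qed
  then obtain c where c0: "\<And>n. n \<in> {1..N} \<Longrightarrow> c n > 0"
    and c: "\<And>n t b. n \<in> {1..N} \<Longrightarrow> norm_bound (A n ^\<^sub>m t) b \<Longrightarrow> c n * \<rho> n ^ t \<le> b"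
    by metis
  have prod_ge: "(\<Prod>n\<in>S. c n) * (\<Prod>n\<in>S. \<rho> n) ^ t \<le> (\<Prod>n\<in>S. b n)"
    if "S \<subseteq> {1..N}" and b: "\<forall>n\<in>{1..N}. norm_bound (A n ^\<^sub>m t) (b n)" for S t b
  proof -
    have "(\<Prod>n\<in>S. c n * \<rho> n ^ t) \<le> (\<Prod>n\<in>S. b n)"
      using that c0 \<rho>0 by (intro prod_mono) (auto intro!: c mult_nonneg_nonneg less_imp_le[OF c0])
    then show ?thesis by (simp add: prod.distrib prod_power_distrib)
  qed

  have P_le: "P \<le> 1" if st: "mlti_stable N J A"
  proof (rule ccontr)
    assume "\<not> P \<le> 1"
    then have P: "P > 1" by simp
    obtain \<gamma> where \<gamma>: "\<And>t. \<exists>b. (\<forall>n\<in>{1..N}. norm_bound (A n ^\<^sub>m t) (b n)) \<and> (\<Prod>n=1..N. b n) \<le> \<gamma>"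
      using mlti_stable_imp_prod_norm_bounds[OF J A st] by blast
    have C: "(\<Prod>n=1..N. c n) > 0" by (intro prod_pos) (use c0 in auto)
    \<comment> \<open>At this time the lower bound from the dominant eigenvectors exceeds the bound
      \<gamma> given by stability.\<close>
    obtain t where t: "\<gamma> / (\<Prod>n=1..N. c n) < P ^ t" using real_arch_pow[OF P] by blast
    obtain b where "\<forall>n\<in>{1..N}. norm_bound (A n ^\<^sub>m t) (b n)" "(\<Prod>n=1..N. b n) \<le> \<gamma>"
      using \<gamma> by blast
    with prod_ge[OF subset_refl, of t b] have "(\<Prod>n=1..N. c n) * P ^ t \<le> \<gamma>"
      unfolding P_def by simp
    then show False using t C by (simp add: field_simps)
  qed

  have ss: semisimple if st: "mlti_stable N J A" and P: "P = 1"
  proof (rule ccontr)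
    assume "\<not> semisimple"
    then obtain m e where m: "m \<in> {1..N}" and e: "cmod e = \<rho> m"
      and ne: "alg_multiplicity (complexify (A m)) e \<noteq> geom_multiplicity (complexify (A m)) e"
      unfolding semisimple_def by blast
    have "\<rho> m \<noteq> 0" using P m unfolding P_def by (metis finite_atLeastAtMost prod_zero_iff zero_neq_one)
    then have "e \<noteq> 0" using e by auto
    from norm_bound_pow_ge_defective[OF cA[OF m] this ne] obtain a d where a: "a > 0"
      and ad: "\<And>t b. norm_bound (A m ^\<^sub>m t) b \<Longrightarrow> (a * real t - d) * \<rho> m ^ t \<le> b"
      unfolding norm_bound_complexify_pow[OF A[OF m]] e by blast
    obtain \<gamma> where \<gamma>0: "\<gamma> > 0"
      and \<gamma>: "\<And>t. \<exists>b. (\<forall>n\<in>{1..N}. norm_bound (A n ^\<^sub>m t) (b n)) \<and> (\<Prod>n=1..N. b n) \<le> \<gamma>"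
      using mlti_stable_imp_prod_norm_bounds[OF J A st] by blast
    let ?S = "{1..N} - {m}"
    define C where "C = (\<Prod>n\<in>?S. c n)"
    have C: "C > 0" unfolding C_def by (intro prod_pos) (use c0 in auto)
    \<comment> \<open>Mode \<open>m\<close> grows by an extra factor of at least
      \<open>a * real t - d\<close>, and the other modes contribute at least \<open>C\<close> apart
      from powers of the radii. This \<open>t\<close> pushes the product of both above
      \<gamma>.\<close>
    obtain t where t: "(d + \<gamma> / C) / a < real t" using reals_Archimedean2 by blast
    then have t: "\<gamma> / C < a * real t - d" using a by (simp add: field_simps)
    then have td: "a * real t - d \<ge> 0" using divide_pos_pos[OF \<gamma>0 C] by simp
    obtain b where b: "\<forall>n\<in>{1..N}. norm_bound (A n ^\<^sub>m t) (b n)" "(\<Prod>n=1..N. b n) \<le> \<gamma>"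
      using \<gamma> by blast
    have le: "(a * real t - d) * \<rho> m ^ t \<le> b m" using ad b(1) m by blast
    have \<rho>S: "0 \<le> (\<Prod>n\<in>?S. \<rho> n) ^ t" using \<rho>0 by (intro zero_le_power prod_nonneg) auto
    \<comment> \<open>Inserting \<open>P ^ t = 1\<close> supplies the powers of the radii, which are
      then split between mode \<open>m\<close> and the remaining modes.\<close>
    have "(a * real t - d) * C = (a * real t - d) * C * P ^ t" using P by simp
    also have "P ^ t = \<rho> m ^ t * (\<Prod>n\<in>?S. \<rho> n) ^ t"
      unfolding P_def prod.remove[OF finite_atLeastAtMost m, of \<rho>] by (rule power_mult_distrib)
    also have "(a * real t - d) * C * (\<rho> m ^ t * (\<Prod>n\<in>?S. \<rho> n) ^ t) =
        ((a * real t - d) * \<rho> m ^ t) * (C * (\<Prod>n\<in>?S. \<rho> n) ^ t)" by simp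
    also have "\<dots> \<le> b m * (\<Prod>n\<in>?S. b n)"
    proof (rule mult_mono[OF le])
      show "C * (\<Prod>n\<in>?S. \<rho> n) ^ t \<le> (\<Prod>n\<in>?S. b n)"
        unfolding C_def using b(1) by (intro prod_ge) auto
      \<comment> \<open>Monotonicity of the product needs this sign; it holds since \<open>t\<close>
        was chosen with \<open>a * real t - d\<close> non-negative.\<close>
      show "0 \<le> b m" using le td \<rho>0[OF m] by (meson mult_nonneg_nonneg order_trans zero_le_power)
      show "0 \<le> C * (\<Prod>n\<in>?S. \<rho> n) ^ t" using C \<rho>S by simp
    qed
    also have "\<dots> = (\<Prod>n=1..N. b n)"
      by (rule prod.remove[OF finite_atLeastAtMost m, symmetric])
    finally have "(a * real t - d) * C \<le> \<gamma>" using b(2) by simp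
    then show False using t C by (simp add: field_simps)
  qed

  have "mlti_stable N J A \<longleftrightarrow> P \<le> 1 \<and> (P = 1 \<longrightarrow> semisimple)"
    using stable_lt stable_eq P_le ss by (auto simp: le_less)
  \<comment> \<open>Instability for a product above 1 is the contrapositive of the first condition
    in the equivalence.\<close>
  then show ?thesis
    using asymp unfolding semisimple_def P_def mlti_unstable_def by auto
qed

end
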